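(* Let $p_1,\dots,p_N$ and $t_1,\dots,t_N>0$ be real numbers with $\frac{p_1}{t_1}\ge\dots\ge\frac{p_N}{t_N}$, and let $k,n\ge1$ be integers with $k+n\le N$. Suppose that for each $i=1,\dots,N$ we have $c\le p_i\le d$ for some $c,d\in(0,1)$ and $t_i=T$ for some $T>0$ (with $c,d,T$ independent of $i$). Then $$EXC\ge T\,c\,\frac{p_k-p_{k+n}}{1-p_k}\,\frac{(1-d)^k}{d^2}\left(A-B(1-d)^{n-1}\right),$$ where $$A=1+kd\left[1-\frac{1-p_k}{1-d}\,\frac dc\,\frac{e^{-S_{k-1}}}{(1-d)^{k-1}}\right],\qquad B=1-d+d(n+k)\left(1-\frac dc\right).$$
   Context: Here $p_i$ is the success probability and $t_i$ the execution time of the $i$-th solution candidate. $S_m=\sum_{i=1}^m p_i$, $T_m=\sum_{i=1}^m t_i$, $Q_m=\prod_{i=1}^m(1-p_i)$ (empty sums are $0$, empty products are $1$). The quantity $EXC$ (the excess expected time caused by exchanging the $k$-th and $(k+n)$-th candidates in the optimal order) is defined by $EXC=q_1+q_2+q_3$ with $$q_1=T_{k-1}Q_{k-1}(p_{k+n}-p_k)+Q_{k-1}(t_{k+n}p_{k+n}-t_kp_k),$$ $$q_2=\sum_{l=k+1}^{k+n-1}Q_{l-1}\,p_l\left(T_l\,\frac{p_k-p_{k+n}}{1-p_k}+(t_{k+n}-t_k)\frac{1-p_{k+n}}{1-p_k}\right),$$ $$q_3=T_{k+n}\,Q_{k+n-1}\,\frac{p_k-p_{k+n}}{1-p_k}.$$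 *)

theory Defs
  imports Complex_Main
begin

text \<open>
  Solution candidates are numbered from 1: \<open>p i\<close> and \<open>t i\<close> are the success probability and the
  execution time of the \<open>i\<close>-th candidate. Values at indices outside \<open>{1..N}\<close> are irrelevant.
\<close>

definition S :: "(nat \<Rightarrow> real) \<Rightarrow> nat \<Rightarrow> real" where
  "S p m = (\<Sum>i=1..m. p i)"

definition T :: "(nat \<Rightarrow> real) \<Rightarrow> nat \<Rightarrow> real" where
  "T t m = (\<Sum>i=1..m. t i)"

definition Q :: "(nat \<Rightarrow> real) \<Rightarrow> nat \<Rightarrow> real" where
  "Q p m = (\<Prod>i=1..m. 1 - p i)"

text \<open>
  The excess expected time caused by exchanging the \<open>k\<close>-th and the \<open>(k+n)\<close>-th candidate.
  The definitions are meant for \<open>k \<ge> 1\<close> and \<open>n \<ge> 1\<close>, so the subtractions on indices do not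
  truncate; for \<open>n = 1\<close> the sum in \<open>q2\<close> is empty.
\<close>

definition q1 :: "(nat \<Rightarrow> real) \<Rightarrow> (nat \<Rightarrow> real) \<Rightarrow> nat \<Rightarrow> nat \<Rightarrow> real" where
  "q1 p t k n =
     T t (k - 1) * Q p (k - 1) * (p (k + n) - p k)
     + Q p (k - 1) * (t (k + n) * p (k + n) - t k * p k)"

definition q2 :: "(nat \<Rightarrow> real) \<Rightarrow> (nat \<Rightarrow> real) \<Rightarrow> nat \<Rightarrow> nat \<Rightarrow> real" where
  "q2 p t k n =
     (\<Sum>l=k+1..k+n-1. Q p (l - 1) * p l *
        (T t l * ((p k - p (k + n)) / (1 - p k))
         + (t (k + n) - t k) * ((1 - p (k + n)) / (1 - p k))))"

definition q3 :: "(nat \<Rightarrow> real) \<Rightarrow> (nat \<Rightarrow> real) \<Rightarrow> nat \<Rightarrow> nat \<Rightarrow> real" where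
  "q3 p t k n = T t (k + n) * Q p (k + n - 1) * ((p k - p (k + n)) / (1 - p k))"

definition EXC :: "(nat \<Rightarrow> real) \<Rightarrow> (nat \<Rightarrow> real) \<Rightarrow> nat \<Rightarrow> nat \<Rightarrow> real" where
  "EXC p t k n = q1 p t k n + q2 p t k n + q3 p t k n"

end

theory Submission
  imports Defs
begin

text \<open>
  If all execution times equal \<open>\<tau>\<close>, then \<open>T\<^sub>l = l\<tau>\<close> and the terms of \<open>EXC\<close> with the factor
  \<open>t\<^sub>k\<^sub>+\<^sub>n - t\<^sub>k\<close> vanish, so \<open>EXC\<close> has the common factor \<open>\<tau> (p\<^sub>k - p\<^sub>k\<^sub>+\<^sub>n) / (1 - p\<^sub>k)\<close>
  (lemma \<open>EXC_const_time\<close>). The factor is nonnegative because with equal times the ordering says that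
  \<open>p\<close> decreases. What remains is to bound from below
  \<open>(\<Sum>l=k+1..k+n-1. l Q\<^sub>l\<^sub>-\<^sub>1 p\<^sub>l) + (k + n) Q\<^sub>k\<^sub>+\<^sub>n\<^sub>-\<^sub>1 - k (1 - p\<^sub>k) Q\<^sub>k\<^sub>-\<^sub>1\<close>.

  In the two positive terms \<open>p\<^sub>l \<ge> c\<close> and \<open>Q\<^sub>m \<ge> (1 - d)\<^sup>m\<close>; in the negative term
  \<open>Q\<^sub>k\<^sub>-\<^sub>1 \<le> exp (- S\<^sub>k\<^sub>-\<^sub>1)\<close>, since \<open>1 - x \<le> exp (- x)\<close>. The bound that results contains the sum of
  \<open>l (1 - d)\<^sup>l\<^sup>-\<^sup>1\<close>, and its closed form (lemma \<open>sum_arith_geometric\<close>) turns the bound exactly into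
  the right-hand side: in \<open>A\<close> the exponential and in \<open>B\<close> the part with \<open>d / c\<close> account for the
  negative term and for the term with \<open>Q\<^sub>k\<^sub>+\<^sub>n\<^sub>-\<^sub>1\<close>, and everything else is the sum.
\<close>

lemma sum_arith_geometric:
  fixes d :: "'a :: comm_ring_1"
  shows "d\<^sup>2 * (\<Sum>l=k+1..k+m. of_nat l * (1 - d) ^ (l - 1)) =
         (1 - d) ^ k * (1 + of_nat k * d - (1 - d) ^ m * (1 + d * of_nat (k + m)))"
proof (induction m)
  case 0
  then show ?case by (simp add: algebra_simps)
next
  case (Suc m)
  have "d\<^sup>2 * (\<Sum>l=k+1..k+Suc m. of_nat l * (1 - d) ^ (l - 1)) =
        d\<^sup>2 * (\<Sum>l=k+1..k+m. of_nat l * (1 - d) ^ (l - 1)) +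
        d\<^sup>2 * (of_nat (k + m + 1) * ((1 - d) ^ k * (1 - d) ^ m))"
    by (simp add: algebra_simps power_add)
  also have "\<dots> = (1 - d) ^ k * (1 + of_nat k * d - (1 - d) ^ Suc m * (1 + d * of_nat (k + Suc m)))"
    unfolding Suc by (simp add: algebra_simps power2_eq_square)
  finally show ?case .
qed

lemma Q_ge_power:
  assumes "\<forall>i\<in>{1..m}. p i \<le> d" and "d \<le> 1"
  shows "(1 - d) ^ m \<le> Q p m"
proof -
  have "(\<Prod>i=1..m. 1 - d) \<le> (\<Prod>i=1..m. 1 - p i)"
    using assms by (intro prod_mono) auto
  then show ?thesis by (simp add: Q_def)
qed

lemma Q_le_exp:
  assumes "\<forall>i\<in>{1..m}. p i \<le> 1"
  shows "Q p m \<le> exp (- S p m)"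
proof -
  have "(\<Prod>i=1..m. 1 - p i) \<le> (\<Prod>i=1..m. exp (- p i))"
  proof (intro prod_mono conjI)
    fix i assume "i \<in> {1..m}"
    then show "0 \<le> 1 - p i" using assms by auto
    show "1 - p i \<le> exp (- p i)" using exp_ge_add_one_self[of "- p i"] by simp
  qed
  then show ?thesis by (simp add: Q_def S_def sum_negf flip: exp_sum)
qed

lemma T_const:
  assumes "\<forall>i\<in>{1..m}. t i = \<tau>"
  shows "T t m = real m * \<tau>"
  using assms by (simp add: T_def)

text \<open>
  Writing the negative term \<open>q1\<close> with \<open>1 - p k\<close> in the denominator as well is what lets the three
  parts share one factor.
\<close>

lemma EXC_const_time:
  assumes t: "\<forall>i\<in>{1..k+n}. t i = \<tau>" and k: "k \<ge> 1" and n: "n \<ge> 1" and "p k \<noteq> 1"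
  shows "EXC p t k n = \<tau> * ((p k - p (k + n)) / (1 - p k)) *
    ((\<Sum>l=k+1..k+n-1. real l * (Q p (l - 1) * p l)) + real (k + n) * Q p (k + n - 1)
     - real k * (1 - p k) * Q p (k - 1))"
proof -
  define r where "r = (p k - p (k + n)) / (1 - p k)"
  have r: "p (k + n) - p k = - (r * (1 - p k))"
    using \<open>p k \<noteq> 1\<close> by (simp add: r_def)
  have tk: "t k = \<tau>" "t (k + n) = \<tau>" using t k by auto
  have Tl: "T t l = real l * \<tau>" if "l \<le> k + n" for l
    using that t by (intro T_const) auto
  have "q1 p t k n = real k * \<tau> * Q p (k - 1) * (p (k + n) - p k)"
    using k by (simp add: q1_def tk Tl of_nat_diff algebra_simps)
  then have 1: "q1 p t k n = \<tau> * r * - (real k * (1 - p k) * Q p (k - 1))"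
    unfolding r by simp
  have 2: "q2 p t k n = \<tau> * r * (\<Sum>l=k+1..k+n-1. real l * (Q p (l - 1) * p l))"
    unfolding q2_def sum_distrib_left
    by (intro sum.cong) (auto simp: tk Tl r_def)
  have 3: "q3 p t k n = \<tau> * r * (real (k + n) * Q p (k + n - 1))"
    by (simp add: q3_def Tl r_def)
  show ?thesis
    unfolding EXC_def 1 2 3 by (simp add: r_def algebra_simps)
qed

lemma antimono_of_ratio_ordered:
  fixes p t :: "nat \<Rightarrow> real"
  assumes ordered: "\<forall>i\<in>{1..<N}. p i / t i \<ge> p (i + 1) / t (i + 1)"
    and t: "\<forall>i\<in>{1..N}. t i = \<tau>" and "\<tau> > 0" and "1 \<le> k" and "k + n \<le> N"
  shows "p (k + n) \<le> p k"
  using \<open>k + n \<le> N\<close>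
proof (induction n)
  case 0
  then show ?case by simp
next
  case (Suc n)
  from ordered Suc.prems \<open>1 \<le> k\<close> have "p (k + n + 1) / t (k + n + 1) \<le> p (k + n) / t (k + n)"
    by simp
  moreover have "t (k + n + 1) = \<tau>" "t (k + n) = \<tau>"
    using t Suc.prems \<open>1 \<le> k\<close> by auto
  ultimately have "p (k + n + 1) \<le> p (k + n)"
    using \<open>\<tau> > 0\<close> by (simp add: divide_le_cancel)
  with Suc show ?case by simp
qed

theorem theorem4p5:
  fixes p t :: "nat \<Rightarrow> real" and N k n :: nat and c d \<tau> :: real
  assumes t_pos: "\<forall>i\<in>{1..N}. t i > 0"
    and ordered: "\<forall>i\<in>{1..<N}. p i / t i \<ge> p (i + 1) / t (i + 1)"
    and k: "k \<ge> 1" and n: "n \<ge> 1" and kn: "k + n \<le> N"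
    and c: "c \<in> {0<..<1}" and d: "d \<in> {0<..<1}" and tau: "\<tau> > 0"
    and p_bounds: "\<forall>i\<in>{1..N}. c \<le> p i \<and> p i \<le> d"
    and t_const: "\<forall>i\<in>{1..N}. t i = \<tau>"
  shows "let A = 1 + real k * d *
               (1 - (1 - p k) / (1 - d) * (d / c) * (exp (- S p (k - 1)) / (1 - d) ^ (k - 1)));
             B = 1 - d + d * (real n + real k) * (1 - d / c)
         in EXC p t k n \<ge>
              \<tau> * c * ((p k - p (k + n)) / (1 - p k)) * ((1 - d) ^ k / d\<^sup>2)
              * (A - B * (1 - d) ^ (n - 1))"
proof -
  have c0: "c > 0" and d0: "d > 0" and d1: "d < 1" using c d by auto
  have pk1: "p k < 1" using p_bounds k kn d1 by force
  define m where "m = n - 1"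
  have nm: "n = Suc m" using n by (simp add: m_def)
  obtain j where kj: "k = Suc j" using k by (cases k) auto
  define r where "r = (p k - p (k + n)) / (1 - p k)"
  have r0: "r \<ge> 0"
    unfolding r_def
    using antimono_of_ratio_ordered[OF ordered t_const tau k kn] pk1 by simp
  define x where "x = 1 - d"
  have x0: "x > 0" using d1 by (simp add: x_def)
  have Qge: "x ^ l \<le> Q p l" if "l \<le> N" for l
    unfolding x_def using that p_bounds d1 by (intro Q_ge_power) auto
  have Qle: "Q p (k - 1) \<le> exp (- S p (k - 1))"
  proof (intro Q_le_exp ballI)
    fix i assume "i \<in> {1..k - 1}"
    then have "p i \<le> d" using p_bounds kn by auto
    then show "p i \<le> 1" using d1 by simp
  qed
  define G where "G = (\<Sum>l=k+1..k+n-1. real l * x ^ (l - 1))"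
  define E where "E = exp (- S p (k - 1))"
  have "c * G \<le> (\<Sum>l=k+1..k+n-1. real l * (Q p (l - 1) * p l))"
    unfolding G_def sum_distrib_left
  proof (rule sum_mono)
    fix l assume l: "l \<in> {k+1..k+n-1}"
    then have "c \<le> p l" using p_bounds kn by auto
    moreover have "x ^ (l - 1) \<le> Q p (l - 1)" using l kn by (intro Qge) auto
    ultimately have "x ^ (l - 1) * c \<le> Q p (l - 1) * p l"
      using c0 x0 by (intro mult_mono) (auto intro: order_trans[of 0 "x ^ (l - 1)"])
    then have "real l * (x ^ (l - 1) * c) \<le> real l * (Q p (l - 1) * p l)"
      by (rule mult_left_mono) simp
    then show "c * (real l * x ^ (l - 1)) \<le> real l * (Q p (l - 1) * p l)"
      by (simp add: mult_ac)
  qed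
  moreover have "real (k + n) * x ^ (k + n - 1) \<le> real (k + n) * Q p (k + n - 1)"
    using kn by (intro mult_left_mono Qge) auto
  moreover have "real k * (1 - p k) * Q p (k - 1) \<le> real k * (1 - p k) * E"
    unfolding E_def using Qle pk1 by (intro mult_left_mono) auto
  ultimately have bound:
    "c * G + real (k + n) * x ^ (k + n - 1) - real k * (1 - p k) * E
     \<le> (\<Sum>l=k+1..k+n-1. real l * (Q p (l - 1) * p l)) + real (k + n) * Q p (k + n - 1)
        - real k * (1 - p k) * Q p (k - 1)"
    by linarith
  have EXC: "EXC p t k n = \<tau> * r *
     ((\<Sum>l=k+1..k+n-1. real l * (Q p (l - 1) * p l)) + real (k + n) * Q p (k + n - 1)
        - real k * (1 - p k) * Q p (k - 1))"
    unfolding r_def using t_const kn k n pk1 by (intro EXC_const_time) auto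
  have "\<tau> * r * (c * G + real (k + n) * x ^ (k + n - 1) - real k * (1 - p k) * E) \<le> EXC p t k n"
    unfolding EXC using bound r0 tau by (intro mult_left_mono) auto
  moreover have
    "c * (x ^ k / d\<^sup>2) *
       ((1 + real k * d * (1 - (1 - p k) / x * (d / c) * (E / x ^ (k - 1))))
        - (x + d * (real n + real k) * (1 - d / c)) * x ^ (n - 1))
     = c * G + real (k + n) * x ^ (k + n - 1) - real k * (1 - p k) * E"
  proof -
    have "d\<^sup>2 * G = x ^ k * (1 + real k * d - x ^ m * (1 + d * real (k + m)))"
      using sum_arith_geometric[of d k m] by (simp add: G_def nm x_def)
    then have G: "G = x ^ k / d\<^sup>2 * (1 + real k * d - x ^ m * (1 + d * real (k + m)))"
      using d0 by (simp add: field_simps)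
    have exp_part: "c * (x ^ k / d\<^sup>2) * (real k * d * ((1 - p k) / x * (d / c) * (E / x ^ (k - 1))))
          = real k * (1 - p k) * E"
      using c0 d0 x0 by (simp add: kj field_simps power2_eq_square)
    have Q_part: "c * (x ^ k / d\<^sup>2) * (d * real (k + n) * (d / c) * x ^ (n - 1))
          = real (k + n) * x ^ (k + n - 1)"
      using c0 d0 x0 by (simp add: nm power_add field_simps power2_eq_square)
    \<comment> \<open>the closed form of \<open>G\<close> appears here because \<open>x + d (k + n) = 1 + d (k + n - 1)\<close>\<close>
    have G_part: "c * (x ^ k / d\<^sup>2) * (1 + real k * d - x ^ (n - 1) * (x + d * real (k + n))) = c * G"
      unfolding G by (simp add: x_def nm algebra_simps)
    have split: "W * ((1 + real k * d * (1 - a)) - (x + d * (real n + real k) * (1 - f)) * y)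
          = W * (1 + real k * d - y * (x + d * real (k + n)))
            + W * (d * real (k + n) * f * y) - W * (real k * d * a)" for W a f y
      by (simp add: algebra_simps)
    show ?thesis
      unfolding split exp_part Q_part G_part ..
  qed
  moreover have "\<tau> * c * r * (x ^ k / d\<^sup>2) * Z = \<tau> * r * (c * (x ^ k / d\<^sup>2) * Z)" for Z
    by (simp only: mult_ac)
  ultimately show ?thesis
    unfolding Let_def r_def[symmetric] x_def[symmetric] E_def[symmetric] by (simp only:)
qed

end
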